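(* The curious numbers that are perfect squares are exactly $0, 1, 4, 9, 121, 484, 676,$ and $44944$.
   Context: For nonnegative integers $m,n$, an integer is called $(m,n)$-curious if its base ten representation is $$\underbrace{a \ldots a}_{m}\, \underbrace{b \ldots b}_{n}\, \underbrace{a \ldots a}_{m}$$ (a concatenation of digits) for some integers $1 \leq a \leq 9$ and $0 \leq b \leq 9$. Equivalently, the integer equals $$a \cdot 10^{m+n} \cdot \frac{10^m-1}{9} + b \cdot 10^m \cdot \frac{10^n-1}{9} + a\cdot \frac{10^m-1}{9}.$$ An integer is called curious if it is $(m,n)$-curious for some nonnegative integers $m,n$ (so the repdigits, including $0$, are the $(0,n)$-curious numbers). A perfect square is the square of an integer. *)

theory Defs
  imports Complex_Main "HOL-Computational_Algebra.Nth_Powers"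
begin

text \<open>
  The integer denoted by a string of decimal digits, most significant digit first. Leading zeros
  are harmless and the empty string denotes \<open>0\<close>; this only matters for \<open>m = 0\<close> below, where the
  strings \<open>b\<dots>b\<close> include the empty one and \<open>0\<dots>0\<close>.
\<close>

definition decimal_value :: "nat list \<Rightarrow> int" where
  "decimal_value ds = horner_sum int 10 (rev ds)"

definition mn_curious :: "nat \<Rightarrow> nat \<Rightarrow> int \<Rightarrow> bool" where
  "mn_curious m n x \<longleftrightarrow>
     (\<exists>a b. 1 \<le> a \<and> a \<le> 9 \<and> b \<le> 9 \<and>
        x = decimal_value (replicate m a @ replicate n b @ replicate m a))"

definition curious :: "int \<Rightarrow> bool" where
  "curious x \<longleftrightarrow> (\<exists>m n. mn_curious m n x)"

lemma decimal_value_append: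
  "decimal_value (xs @ ys) = decimal_value xs * 10 ^ length ys + decimal_value ys"
  by (simp add: decimal_value_def horner_sum_append algebra_simps)

lemma decimal_value_replicate:
  "decimal_value (replicate n d) = int d * ((10 ^ n - 1) div 9)"
proof -
  have *: "9 * decimal_value (replicate n d) = int d * (10 ^ n - 1)"
    by (induction n) (simp_all add: decimal_value_def horner_sum_append algebra_simps
        flip: replicate_append_same)
  have "(10::int) - 1 dvd 10 ^ n - 1 ^ n"
    unfolding power_diff_sumr2 by (rule dvd_triv_left)
  then have "(9::int) dvd 10 ^ n - 1"
    by simp
  then obtain k where k: "(10::int) ^ n - 1 = 9 * k" ..
  from * show ?thesis by (simp add: k)
qed

lemma mn_curious_iff:
  "mn_curious m n x \<longleftrightarrow>
     (\<exists>a b::nat. 1 \<le> a \<and> a \<le> 9 \<and> b \<le> 9 \<and>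
        x = int a * 10 ^ (m + n) * ((10 ^ m - 1) div 9)
          + int b * 10 ^ m * ((10 ^ n - 1) div 9)
          + int a * ((10 ^ m - 1) div 9))"
  by (simp add: mn_curious_def decimal_value_append decimal_value_replicate
      power_add algebra_simps)

end

theory Submission
  imports Defs
begin

text \<open>
  Write the number as \<open>y\<^sup>2\<close>; then \<open>(3 y)\<^sup>2 = A 10\<^sup>n + B\<close> with \<open>A = (a 10\<^sup>m + b - a) 10\<^sup>m\<close> and
  \<open>B = (a - b) 10\<^sup>m - a\<close>. A square cannot end in four equal nonzero digits, so \<open>m \<le> 3\<close> (and
  \<open>n \<le> 3\<close> if \<open>m = 0\<close> and \<open>b \<noteq> 0\<close>).
  For \<open>n \<ge> 5\<close> the number \<open>B\<close> is a square modulo \<open>64\<close> and \<open>25\<close>, which leaves few triples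
  \<open>(m, a, b)\<close>. For each of them \<open>A 10\<^sup>n + B\<close> is, for every residue class of \<open>n\<close>, a quadratic
  nonresidue modulo one of a few small moduli for which the powers of \<open>10\<close> have a short period.
\<close>

text \<open>Listing the squares of all residues lets \<open>code_simp\<close> decide it; the moduli
  below include the composites 16, 25, 27 and 64.\<close>

definition nonsquare_mod :: "int \<Rightarrow> int \<Rightarrow> bool" where
  "nonsquare_mod p c \<longleftrightarrow> c mod p \<notin> set (map (\<lambda>y. y * y mod p) [0..p - 1])"

lemma nonsquare_mod_not_square:
  assumes "nonsquare_mod p c" "p > 0"
  shows "z\<^sup>2 \<noteq> c"
proof
  assume "z\<^sup>2 = c"
  then have "c mod p = (z mod p) * (z mod p) mod p"
    by (simp add: power2_eq_square mod_mult_eq)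
  moreover have "z mod p \<in> {0..p - 1}"
    using \<open>p > 0\<close> by simp
  ultimately show False
    using assms(1) by (auto simp: nonsquare_mod_def)
qed

lemma nonsquare_mod_cong:
  "c mod p = d mod p \<Longrightarrow> nonsquare_mod p c \<longleftrightarrow> nonsquare_mod p d"
  by (simp add: nonsquare_mod_def)

text \<open>Modulo each \<open>p\<close> the value \<open>A * 10 ^ n + B\<close> depends only on
  \<open>n mod k\<close>, so \<open>k\<close> checks settle every \<open>n\<close>; each residue may
  use its own modulus.\<close>

definition periodic_obstruction :: "nat \<Rightarrow> int list \<Rightarrow> int \<Rightarrow> int \<Rightarrow> bool" where
  "periodic_obstruction k ps A B \<longleftrightarrow> k > 0 \<and> (\<forall>p\<in>set ps. p > 1 \<and> 10 ^ k mod p = 1) \<and>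
     (\<forall>r\<in>set [0..<k]. \<exists>p\<in>set ps. nonsquare_mod p (A * 10 ^ r + B))"

lemma periodic_obstruction_not_square:
  assumes "periodic_obstruction k ps A B"
  shows "z\<^sup>2 \<noteq> A * 10 ^ n + B"
proof -
  have "n mod k \<in> set [0..<k]"
    using assms by (simp add: periodic_obstruction_def)
  then obtain p where p: "p > 1" "10 ^ k mod p = 1"
    and ns: "nonsquare_mod p (A * 10 ^ (n mod k) + B)"
    using assms unfolding periodic_obstruction_def by blast
  have "(10::int) ^ n = (10 ^ k) ^ (n div k) * 10 ^ (n mod k)"
    by (simp flip: power_mult power_add)
  also have "\<dots> mod p = ((10 ^ k mod p) ^ (n div k) mod p) * 10 ^ (n mod k) mod p"
    by (simp add: power_mod mod_mult_left_eq)
  also have "\<dots> = 10 ^ (n mod k) mod p"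
    using p by simp
  finally have "(A * 10 ^ n + B) mod p = (A * 10 ^ (n mod k) + B) mod p"
    by (metis mod_add_left_eq mod_mult_right_eq)
  then have "nonsquare_mod p (A * 10 ^ n + B)"
    using ns nonsquare_mod_cong by blast
  then show ?thesis
    using nonsquare_mod_not_square p(1) by simp
qed

lemma nine_times_repunit: "9 * (((10::int) ^ n - 1) div 9) = 10 ^ n - 1"
proof -
  have "(10::int) ^ n mod 9 = (10 mod 9) ^ n mod 9"
    by (simp only: power_mod)
  then have "(9::int) dvd 10 ^ n - 1"
    by (intro mod_eq_dvd_iff[THEN iffD1]) simp
  then show ?thesis
    by simp
qed

text \<open>The factor 9 clears the repunits and is itself a square, so squares stay
  squares.\<close>

lemma nine_times_curious:
  fixes a b :: int
  shows "9 * (a * 10 ^ (m + n) * ((10 ^ m - 1) div 9) + b * 10 ^ m * ((10 ^ n - 1) div 9)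
      + a * ((10 ^ m - 1) div 9))
    = (a * 10 ^ m + b - a) * 10 ^ m * 10 ^ n + ((a - b) * 10 ^ m - a)"
  (is "9 * (_ * ?R m + _ * ?R n + _ * _) = _")
proof -
  have "9 * (a * 10 ^ (m + n) * ?R m + b * 10 ^ m * ?R n + a * ?R m)
    = a * 10 ^ (m + n) * (9 * ?R m) + b * 10 ^ m * (9 * ?R n) + a * (9 * ?R m)"
    by (simp only: algebra_simps)
  also have "\<dots> = (a * 10 ^ m + b - a) * 10 ^ m * 10 ^ n + ((a - b) * 10 ^ m - a)"
    unfolding nine_times_repunit by (simp add: power_add algebra_simps)
  finally show ?thesis .
qed

text \<open>Nine times a number ending in \<open>dddd\<close> is congruent to \<open>- d\<close>
  modulo \<open>10 ^ 4\<close>, hence this form.\<close>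

lemma square_not_four_equal_digits:
  fixes d z q :: int
  assumes "1 \<le> d" "d \<le> 9"
  shows "z\<^sup>2 \<noteq> q * 10 ^ 4 - d"
proof -
  \<comment> \<open>The squares modulo 16 are 0, 1, 4, 9, which excludes every \<open>d\<close>
    except 7; there -7 is 3 modulo 5.\<close>
  have "\<forall>d\<in>set [1..9::int]. \<exists>p\<in>set [16, 5]. p > 0 \<and> 10 ^ 4 mod p = 0 \<and> nonsquare_mod p (- d)"
    by code_simp
  then obtain p where p: "p > 0" "10 ^ 4 mod p = 0" "nonsquare_mod p (- d)"
    using assms by (metis atLeastAtMost_iff set_upto)
  have "p dvd q * 10 ^ 4"
    using p(2) by (intro dvd_mult) (rule dvd_eq_mod_eq_0[THEN iffD2])
  then have "(q * 10 ^ 4 - d) mod p = (- d) mod p"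
    by (simp add: mod_eq_dvd_iff)
  then show ?thesis
    using p nonsquare_mod_cong nonsquare_mod_not_square by blast
qed

lemma square_last_digits:
  fixes a b :: int
  assumes "z\<^sup>2 = A * 10 ^ m * 10 ^ n + ((a - b) * 10 ^ m - a)"
    and "m \<in> {1, 2, 3}" "n \<ge> 5" "a \<in> {1..9}" "b \<in> {0..9}"
  shows "(m, a, b) \<in> set [(1, 1, 0), (1, 1, 4), (1, 1, 8), (1, 4, 0), (1, 4, 2), (1, 5, 2), (1, 6, 5),
    (1, 9, 0), (1, 9, 4), (1, 9, 8), (2, 4, 2), (2, 4, 7), (3, 4, 3), (3, 4, 7)]"
proof -
  have digits: "\<forall>m\<in>set [1, 2, 3::nat]. \<forall>a\<in>set [1..9::int]. \<forall>b\<in>set [0..9::int].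
    (m, a, b) \<in> set [(1, 1, 0), (1, 1, 4), (1, 1, 8), (1, 4, 0), (1, 4, 2), (1, 5, 2), (1, 6, 5),
      (1, 9, 0), (1, 9, 4), (1, 9, 8), (2, 4, 2), (2, 4, 7), (3, 4, 3), (3, 4, 7)] \<or>
    (\<exists>p\<in>set [25, 64]. nonsquare_mod p ((a - b) * 10 ^ m - a))"
    by code_simp
  have square: "\<not> (\<exists>p\<in>set [25, 64]. nonsquare_mod p ((a - b) * 10 ^ m - a))"
  proof
    assume "\<exists>p\<in>set [25, 64]. nonsquare_mod p ((a - b) * 10 ^ m - a)"
    then obtain p where p: "p \<in> {25, 64}" and ns: "nonsquare_mod p ((a - b) * 10 ^ m - a)"
      by (simp only: list.set) blast
    \<comment> \<open>64 is \<open>2 ^ 6\<close>, and \<open>m + n\<close> is at least 6 because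
      \<open>m \<ge> 1\<close> and \<open>n \<ge> 5\<close>.\<close>
    have "p dvd 10 ^ 6"
      using p by auto
    also have "(10::int) ^ 6 dvd 10 ^ (m + n)"
      using assms(2,3) by (intro le_imp_power_dvd) auto
    finally have "p dvd A * 10 ^ m * 10 ^ n"
      by (simp add: power_add mult.assoc)
    then have "(A * 10 ^ m * 10 ^ n + ((a - b) * 10 ^ m - a)) mod p = ((a - b) * 10 ^ m - a) mod p"
      by (simp add: mod_eq_dvd_iff)
    then have "(z\<^sup>2) mod p = ((a - b) * 10 ^ m - a) mod p"
      by (simp only: assms(1))
    moreover have "p > 0"
      using p by auto
    ultimately show False
      using ns nonsquare_mod_cong nonsquare_mod_not_square by blast
  qed
  have "m \<in> set [1, 2, 3]" "a \<in> set [1..9]" "b \<in> set [0..9]"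
    using assms(2,4,5) by (simp_all only: set_upto list.set)
  note digits[THEN bspec, OF this(1), THEN bspec, OF this(2), THEN bspec, OF this(3)]
  then show ?thesis
    using square by (simp only: simp_thms)
qed

text \<open>The coefficients for the triples in \<open>square_last_digits\<close>, in the same
  order, without (1, 9, 0): its pair 810, 81 is 9 times the first one. The period is a common
  multiple of the orders of 10 modulo the listed moduli.\<close>

lemma periodic_obstructions:
  "periodic_obstruction 3 [27] 90 9"
  "periodic_obstruction 6 [13] 130 (- 31)"
  "periodic_obstruction 16 [17] 170 (- 71)"
  "periodic_obstruction 3 [27] 360 36"
  "periodic_obstruction 6 [7, 11, 13] 380 16"
  "periodic_obstruction 6 [7, 13] 470 25"
  "periodic_obstruction 8 [101, 137] 590 4"
  "periodic_obstruction 5 [41] 850 41"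
  "periodic_obstruction 6 [7, 11, 13] 890 1"
  "periodic_obstruction 6 [7, 11] 39800 196"
  "periodic_obstruction 6 [13] 40300 (- 304)"
  "periodic_obstruction 21 [43] 3999000 996"
  "periodic_obstruction 4 [101] 4003000 (- 3004)"
  by code_simp+

text \<open>Finitely many numbers remain; sieving by small moduli excludes all but the listed values
  without computing square roots.\<close>

lemma short_curious_squares:
  fixes a b :: int
  assumes "z\<^sup>2 = a * 10 ^ (m + n) * ((10 ^ m - 1) div 9) + b * 10 ^ m * ((10 ^ n - 1) div 9)
      + a * ((10 ^ m - 1) div 9)"
    and "m < 4" "n < 5" "a \<in> {1..9}" "b \<in> {0..9}"
  shows "z\<^sup>2 \<in> {0, 1, 4, 9, 121, 484, 676, 44944}"
proof -
  have "\<forall>m\<in>set [0..<4]. \<forall>n\<in>set [0..<5]. \<forall>a\<in>set [1..9::int]. \<forall>b\<in>set [0..9].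
    let x = a * 10 ^ (m + n) * ((10 ^ m - 1) div 9) + b * 10 ^ m * ((10 ^ n - 1) div 9)
      + a * ((10 ^ m - 1) div 9)
    in (\<exists>p\<in>set [16, 25, 9, 7, 11, 13, 17, 19]. nonsquare_mod p x) \<or>
      x \<in> set [0, 1, 4, 9, 121, 484, 676, 44944]"
    by code_simp
  then have "(\<exists>p\<in>set [16, 25, 9, 7, 11, 13, 17, 19]. nonsquare_mod p (z\<^sup>2)) \<or>
      z\<^sup>2 \<in> set [0, 1, 4, 9, 121, 484, 676, 44944]"
    using assms(2-) unfolding Let_def set_upto set_upt assms(1) by auto
  moreover have "\<not> nonsquare_mod p (z\<^sup>2)" if "p \<in> set [16, 25, 9, 7, 11, 13, 17, 19]" for p
    using that nonsquare_mod_not_square[of p "z\<^sup>2" z] by auto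
  ultimately show ?thesis
    by auto
qed

lemma curious_square_cases:
  fixes a b :: int
  assumes z: "z\<^sup>2 = a * 10 ^ (m + n) * ((10 ^ m - 1) div 9) + b * 10 ^ m * ((10 ^ n - 1) div 9)
      + a * ((10 ^ m - 1) div 9)"
    and ab: "a \<in> {1..9}" "b \<in> {0..9}"
  shows "z\<^sup>2 \<in> {0, 1, 4, 9, 121, 484, 676, 44944}"
proof -
  have eq: "(3 * z)\<^sup>2 = (a * 10 ^ m + b - a) * 10 ^ m * 10 ^ n + ((a - b) * 10 ^ m - a)"
    unfolding power_mult_distrib z nine_times_curious[symmetric] by simp
  have m: "m < 4"
  proof (rule ccontr)
    assume "\<not> m < 4"
    then obtain k where "m = k + 4"
      by (metis add.commute le_Suc_ex not_less)
    with eq have "(3 * z)\<^sup>2 = ((a * 10 ^ m + b - a) * 10 ^ k * 10 ^ n + (a - b) * 10 ^ k) * 10 ^ 4 - a"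
      by (simp add: power_add algebra_simps)
    then show False
      using square_not_four_equal_digits[of a] ab(1) by (metis atLeastAtMost_iff)
  qed
  consider "n < 5" | "m = 0" "n \<ge> 5" | "m \<in> {1, 2, 3}" "n \<ge> 5"
    using m by fastforce
  then show ?thesis
  proof cases
    case 1
    then show ?thesis
      using short_curious_squares z m ab by blast
  next
    case 2
    \<comment> \<open>For \<open>m = 0\<close> the number is the repdigit of \<open>b\<close>, so
      the four-digit argument now applies to \<open>b\<close>.\<close>
    have "b = 0"
    proof (rule ccontr)
      assume "b \<noteq> 0"
      obtain k where "n = k + 4"
        using 2 le_Suc_ex[of 4 n] by (auto simp: add.commute)
      with eq 2 have "(3 * z)\<^sup>2 = b * 10 ^ k * 10 ^ 4 - b"
        by (simp add: power_add algebra_simps)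
      then show False
        using square_not_four_equal_digits[of b "3 * z" "b * 10 ^ k"] ab(2) \<open>b \<noteq> 0\<close>
        by (metis atLeastAtMost_iff int_one_le_iff_zero_less order_le_less)
    qed
    then show ?thesis
      using z 2 by simp
  next
    case 3
    have no: "\<not> periodic_obstruction k ps ((a * 10 ^ m + b - a) * 10 ^ m) ((a - b) * 10 ^ m - a)"
      for k ps
      using periodic_obstruction_not_square eq by blast
    \<comment> \<open>Cancelling 9 from \<open>(3 * z)\<^sup>2\<close> leaves the expression already
      excluded for (1, 1, 0).\<close>
    have "(m, a, b) \<noteq> (1, 9, 0)"
    proof
      assume "(m, a, b) = (1, 9, 0)"
      with eq have "z\<^sup>2 = 90 * 10 ^ n + 9"
        by (simp add: power_mult_distrib)
      then show False
        using periodic_obstruction_not_square periodic_obstructions(1) by blast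
    qed
    then show ?thesis
      using square_last_digits[OF eq 3 ab] no periodic_obstructions by fastforce
  qed
qed

theorem theorem1p1:
  shows "{x::int. curious x \<and> is_square x} = {0, 1, 4, 9, 121, 484, 676, 44944}"
proof (intro equalityI subsetI)
  fix x :: int
  assume x: "x \<in> {x. curious x \<and> is_square x}"
  then obtain z where "x = z\<^sup>2"
    by (auto elim: is_nth_powerE)
  moreover from x obtain m n and a b :: nat where "1 \<le> a" "a \<le> 9" "b \<le> 9"
    "x = int a * 10 ^ (m + n) * ((10 ^ m - 1) div 9) + int b * 10 ^ m * ((10 ^ n - 1) div 9)
      + int a * ((10 ^ m - 1) div 9)"
    unfolding curious_def mn_curious_iff by blast
  ultimately show "x \<in> {0, 1, 4, 9, 121, 484, 676, 44944}"
    using curious_square_cases[of z "int a" m n "int b"] by auto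
next
  fix x :: int
  assume x: "x \<in> {0, 1, 4, 9, 121, 484, 676, 44944}"
  have curiousI: "curious (decimal_value (replicate m a @ replicate n b @ replicate m a))"
    if "1 \<le> a" "a \<le> 9" "b \<le> 9" for m n a b
    using that unfolding curious_def mn_curious_def by blast
  \<comment> \<open>The arguments are \<open>a\<close>, \<open>b\<close>, \<open>m\<close>,
    \<open>n\<close> in this order. For \<open>m = 0\<close> the value \<open>a = 1\<close> is a
    placeholder, and 0 is the value of the empty string.\<close>
  have "curious x"
    using x curiousI[of 1 0 0 0] curiousI[of 1 1 0 1] curiousI[of 1 4 0 1] curiousI[of 1 9 0 1]
      curiousI[of 1 2 1 1] curiousI[of 4 8 1 1] curiousI[of 6 7 1 1] curiousI[of 4 9 2 1]
    by (auto simp: decimal_value_def numeral_2_eq_2)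
  moreover have "x \<in> (\<lambda>y. y\<^sup>2) ` {0, 1, 2, 3, 11, 22, 26, 212}"
    using x by simp
  then obtain y where "x = y\<^sup>2"
    by blast
  then have "is_square x"
    by simp
  ultimately show "x \<in> {x. curious x \<and> is_square x}"
    by simp
qed

end
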